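(* Let $(X,T)$ be a topological dynamical system, where $X$ is a non-empty compact metric space with metric $d$ and $T:X\to X$ is continuous. Then $(X,T)$ is $\overline F$-continuous if and only if $(X,T)$ is $F$-continuous.
   Context: $S_n$ denotes the group of permutations of $\{1,\dots,n\}$. For $x,y\in X$ define $\overline F(x,y)=\limsup_{n\to+\infty}\inf_{\sigma\in S_n}\frac1n\sum_{k=1}^n d(T^kx,T^{\sigma(k)}y)$ and $\underline F(x,y)=\liminf_{n\to+\infty}\inf_{\sigma\in S_n}\frac1n\sum_{k=1}^n d(T^kx,T^{\sigma(k)}y)$. If $\overline F(x,y)=\underline F(x,y)$, we say $F(x,y)$ exists and denote the common value by $F(x,y)$. $(X,T)$ is $\overline F$-continuous at $x\in X$ if for every $\varepsilon>0$ there is $\delta>0$ such that $\overline F(x,y)<\varepsilon$ whenever $d(x,y)<\delta$; $(X,T)$ is $\overline F$-continuous if this holds at every $x\in X$. $(X,T)$ is $F$-continuous at $x\in X$ if for every $\varepsilon>0$ there is $\delta>0$ such that whenever $d(x,y)<\delta$, $F(x,y)$ exists and $F(x,y)<\varepsilon$; $(X,T)$ is $F$-continuous if this holds at every $x\in X$. *)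

theory Defs
  imports "HOL-Analysis.Analysis"
begin

text \<open>The space is a carrier set X in a type of class metric_space, with metric dist.\<close>

definition topological_dynamical_system :: "'a::metric_space set \<Rightarrow> ('a \<Rightarrow> 'a) \<Rightarrow> bool" where
  "topological_dynamical_system X T \<longleftrightarrow>
     X \<noteq> {} \<and> compact X \<and> T \<in> X \<rightarrow> X \<and> continuous_on X T"

text \<open>The infimum is over a finite nonempty set of reals. The value at n = 0 is the junk
  value 0, which affects neither the upper nor the lower limit.\<close>

definition F_mean :: "('a::metric_space \<Rightarrow> 'a) \<Rightarrow> 'a \<Rightarrow> 'a \<Rightarrow> nat \<Rightarrow> real" where
  "F_mean T x y n =
     (INF \<sigma>\<in>{\<sigma>. \<sigma> permutes {1..n}}.
        1 / real n * (\<Sum>k=1..n. dist ((T ^^ k) x) ((T ^^ \<sigma> k) y)))"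

text \<open>Upper and lower limits are taken in the extended reals, where they always exist;
  for points of a compact space they are finite.\<close>

definition F_upper :: "('a::metric_space \<Rightarrow> 'a) \<Rightarrow> 'a \<Rightarrow> 'a \<Rightarrow> ereal" where
  "F_upper T x y = limsup (\<lambda>n. ereal (F_mean T x y n))"

definition F_lower :: "('a::metric_space \<Rightarrow> 'a) \<Rightarrow> 'a \<Rightarrow> 'a \<Rightarrow> ereal" where
  "F_lower T x y = liminf (\<lambda>n. ereal (F_mean T x y n))"

definition F_exists :: "('a::metric_space \<Rightarrow> 'a) \<Rightarrow> 'a \<Rightarrow> 'a \<Rightarrow> bool" where
  "F_exists T x y \<longleftrightarrow> F_upper T x y = F_lower T x y"

text \<open>The common value of the upper and lower limits; meaningful only if F_exists holds.\<close>

definition F_value :: "('a::metric_space \<Rightarrow> 'a) \<Rightarrow> 'a \<Rightarrow> 'a \<Rightarrow> ereal" where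
  "F_value T x y = (THE c. F_upper T x y = c \<and> F_lower T x y = c)"

definition F_upper_continuous_at :: "'a::metric_space set \<Rightarrow> ('a \<Rightarrow> 'a) \<Rightarrow> 'a \<Rightarrow> bool" where
  "F_upper_continuous_at X T x \<longleftrightarrow>
     (\<forall>\<epsilon>>0::real. \<exists>\<delta>>0::real. \<forall>y\<in>X. dist x y < \<delta> \<longrightarrow> F_upper T x y < ereal \<epsilon>)"

definition F_upper_continuous :: "'a::metric_space set \<Rightarrow> ('a \<Rightarrow> 'a) \<Rightarrow> bool" where
  "F_upper_continuous X T \<longleftrightarrow> (\<forall>x\<in>X. F_upper_continuous_at X T x)"

definition F_continuous_at :: "'a::metric_space set \<Rightarrow> ('a \<Rightarrow> 'a) \<Rightarrow> 'a \<Rightarrow> bool" where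
  "F_continuous_at X T x \<longleftrightarrow>
     (\<forall>\<epsilon>>0::real. \<exists>\<delta>>0::real. \<forall>y\<in>X. dist x y < \<delta> \<longrightarrow>
        F_exists T x y \<and> F_value T x y < ereal \<epsilon>)"

definition F_continuous :: "'a::metric_space set \<Rightarrow> ('a \<Rightarrow> 'a) \<Rightarrow> bool" where
  "F_continuous X T \<longleftrightarrow> (\<forall>x\<in>X. F_continuous_at X T x)"

end

theory Submission
  imports Defs
begin

text \<open>The number \<open>n F\<^sub>n(x,y)\<close> is the optimal matching cost of two orbit segments. It satisfies the
  triangle inequality, is subadditive under concatenation, and changes by a bounded amount when
  \<open>(x,y)\<close> is replaced by \<open>(T x, T y)\<close>. Suppose \<open>F_lower T x y < M\<close>. By the triangle inequality,
  upper continuity forces \<open>F_lower < M\<close>, up to a small error, at every limit of pairs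
  \<open>(T\<^sup>k x, T\<^sup>k y)\<close>. Compactness then gives one \<open>N\<close> such that from every time \<open>k\<close> some segment
  of length at most \<open>N\<close> has mean cost at most \<open>M\<close>. Cutting the orbit into such segments gives
  \<open>F_upper T x y \<le> M\<close>. So \<open>F(x,y)\<close> exists for all \<open>x, y\<close>.\<close>

section \<open>Optimal matching cost: metric properties and concatenation\<close>

text \<open>Undoing the normalisation turns concatenation into plain subadditivity; at
  \<open>n = 0\<close> the cost is 0.\<close>

definition matching_cost :: "('a::metric_space \<Rightarrow> 'a) \<Rightarrow> nat \<Rightarrow> 'a \<Rightarrow> 'a \<Rightarrow> real" where
  "matching_cost T n x y = real n * F_mean T x y n"

lemma F_mean_eq_matching_cost:
  "n > 0 \<Longrightarrow> F_mean T x y n = matching_cost T n x y / real n"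
  by (simp add: matching_cost_def)

lemma matching_cost_le:
  assumes "\<sigma> permutes {1..n}"
  shows "matching_cost T n x y \<le> (\<Sum>k=1..n. dist ((T ^^ k) x) ((T ^^ \<sigma> k) y))"
proof (cases "n = 0")
  case False
  have "F_mean T x y n \<le> 1 / real n * (\<Sum>k=1..n. dist ((T ^^ k) x) ((T ^^ \<sigma> k) y))"
    unfolding F_mean_def
    by (rule cINF_lower)
      (use assms in \<open>auto intro!: bdd_below_finite finite_permutations\<close>)
  then show ?thesis
    using False by (simp add: matching_cost_def field_simps)
qed (simp add: matching_cost_def)

text \<open>The infimum runs over a finite nonempty set, so it is a minimum. The optimal
  permutations obtained here are inverted, composed and glued below.\<close>

lemma matching_cost_attained:
  obtains \<sigma> where "\<sigma> permutes {1..n}"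
    and "matching_cost T n x y = (\<Sum>k=1..n. dist ((T ^^ k) x) ((T ^^ \<sigma> k) y))"
proof -
  let ?f = "\<lambda>\<sigma>. 1 / real n * (\<Sum>k=1..n. dist ((T ^^ k) x) ((T ^^ \<sigma> k) y))"
  let ?P = "{\<sigma>. \<sigma> permutes {1..n}}"
  have Inf_in: "Inf S \<in> S" if "finite S" "S \<noteq> {}" for S :: "real set"
    using that by (simp add: cInf_eq_Min)
  have "finite (?f ` ?P)" "?f ` ?P \<noteq> {}"
    using permutes_id[of "{1..n}"] by (auto intro: finite_permutations simp del: permutes_id)
  then have "Inf (?f ` ?P) \<in> ?f ` ?P"
    by (rule Inf_in)
  then have "F_mean T x y n \<in> ?f ` ?P"
    by (simp only: F_mean_def)
  then obtain \<sigma> where \<sigma>: "\<sigma> permutes {1..n}" "F_mean T x y n = ?f \<sigma>"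
    by auto
  have "matching_cost T n x y = (\<Sum>k=1..n. dist ((T ^^ k) x) ((T ^^ \<sigma> k) y))"
    by (cases "n = 0") (simp_all add: matching_cost_def \<sigma>(2))
  with \<sigma>(1) show ?thesis by (rule that)
qed

lemma matching_cost_le_diagonal:
  "matching_cost T n x y \<le> (\<Sum>k=1..n. dist ((T ^^ k) x) ((T ^^ k) y))"
  using matching_cost_le[OF permutes_id] by simp

text \<open>The inverse of an optimal permutation matches the same pairs of points.\<close>

lemma matching_cost_commute_le: "matching_cost T n y x \<le> matching_cost T n x y"
proof -
  obtain \<sigma> where \<sigma>: "\<sigma> permutes {1..n}"
    "matching_cost T n x y = (\<Sum>k=1..n. dist ((T ^^ k) x) ((T ^^ \<sigma> k) y))"
    by (rule matching_cost_attained)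
  have "matching_cost T n y x \<le> (\<Sum>k=1..n. dist ((T ^^ k) y) ((T ^^ inv \<sigma> k) x))"
    using \<sigma>(1) by (intro matching_cost_le permutes_inv)
  also have "\<dots> = (\<Sum>k=1..n. dist ((T ^^ \<sigma> k) y) ((T ^^ inv \<sigma> (\<sigma> k)) x))"
    by (subst sum.permute[OF \<sigma>(1)]) (simp add: o_def)
  also have "\<dots> = matching_cost T n x y"
    by (simp add: \<sigma>(2) permutes_inverses[OF \<sigma>(1)] dist_commute)
  finally show ?thesis .
qed

lemma matching_cost_commute: "matching_cost T n x y = matching_cost T n y x"
  by (intro antisym matching_cost_commute_le)

text \<open>Compose the optimal permutations and apply the triangle inequality of
  \<open>dist\<close> through the intermediate point \<open>(T ^^ \<sigma> k) y\<close>.\<close>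

lemma matching_cost_triangle:
  "matching_cost T n x z \<le> matching_cost T n x y + matching_cost T n y z"
proof -
  obtain \<sigma> where \<sigma>: "\<sigma> permutes {1..n}"
    "matching_cost T n x y = (\<Sum>k=1..n. dist ((T ^^ k) x) ((T ^^ \<sigma> k) y))"
    by (rule matching_cost_attained)
  obtain \<tau> where \<tau>: "\<tau> permutes {1..n}"
    "matching_cost T n y z = (\<Sum>k=1..n. dist ((T ^^ k) y) ((T ^^ \<tau> k) z))"
    by (rule matching_cost_attained)
  have "matching_cost T n x z \<le> (\<Sum>k=1..n. dist ((T ^^ k) x) ((T ^^ (\<tau> \<circ> \<sigma>) k) z))"
    using \<sigma>(1) \<tau>(1) by (intro matching_cost_le permutes_compose)
  also have "\<dots> \<le> (\<Sum>k=1..n. dist ((T ^^ k) x) ((T ^^ \<sigma> k) y)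
      + dist ((T ^^ \<sigma> k) y) ((T ^^ \<tau> (\<sigma> k)) z))"
    by (intro sum_mono) (simp add: dist_triangle)
  also have "\<dots> = matching_cost T n x y
      + (\<Sum>k=1..n. dist ((T ^^ \<sigma> k) y) ((T ^^ \<tau> (\<sigma> k)) z))"
    by (simp add: \<sigma>(2) sum.distrib)
  \<comment> \<open>Only the order of summation differs: \<open>\<sigma>\<close> permutes the
    indices.\<close>
  also have "(\<Sum>k=1..n. dist ((T ^^ \<sigma> k) y) ((T ^^ \<tau> (\<sigma> k)) z)) = matching_cost T n y z"
    unfolding \<tau>(2) by (subst (2) sum.permute[OF \<sigma>(1)]) (simp add: o_def)
  finally show ?thesis .
qed

text \<open>Optimal matchings of the two consecutive blocks, placed side by side, form one
  admissible matching of the long segment.\<close>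

lemma matching_cost_add:
  "matching_cost T (n + m) x y
    \<le> matching_cost T n x y + matching_cost T m ((T ^^ n) x) ((T ^^ n) y)"
proof -
  obtain \<sigma> where \<sigma>: "\<sigma> permutes {1..n}"
    "matching_cost T n x y = (\<Sum>k=1..n. dist ((T ^^ k) x) ((T ^^ \<sigma> k) y))"
    by (rule matching_cost_attained)
  obtain \<tau> where \<tau>: "\<tau> permutes {1..m}"
    "matching_cost T m ((T ^^ n) x) ((T ^^ n) y)
      = (\<Sum>k=1..m. dist ((T ^^ k) ((T ^^ n) x)) ((T ^^ \<tau> k) ((T ^^ n) y)))"
    by (rule matching_cost_attained)
  \<comment> \<open>The second branch also covers \<open>k > n + m\<close>, where
    \<open>\<tau>\<close> fixes \<open>k - n\<close> and so \<open>\<pi>\<close> fixes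
    \<open>k\<close>; at \<open>k = 0\<close> the first branch gives 0.\<close>
  define \<pi> where "\<pi> k = (if k \<le> n then \<sigma> k else n + \<tau> (k - n))" for k
  have \<sigma>_le: "\<sigma> k \<le> n" if "k \<le> n" for k
    using permutes_in_image[OF \<sigma>(1), of k] permutes_not_in[OF \<sigma>(1), of k] that
    by (cases "k = 0") auto
  have \<sigma>_ge: "1 \<le> \<sigma> k" if "1 \<le> k" "k \<le> n" for k
    using permutes_in_image[OF \<sigma>(1), of k] that by auto
  have \<tau>_in: "1 \<le> \<tau> (k - n) \<and> \<tau> (k - n) \<le> m" if "n < k" "k \<le> n + m" for k
    using permutes_in_image[OF \<tau>(1), of "k - n"] that by auto
  have "inj_on \<pi> {1..n + m}"
  proof (rule inj_onI)
    fix i j assume ij: "i \<in> {1..n + m}" "j \<in> {1..n + m}" "\<pi> i = \<pi> j"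
    then show "i = j"
      using \<sigma>_le[of i] \<sigma>_le[of j] \<tau>_in[of i] \<tau>_in[of j]
        injD[OF permutes_inj[OF \<sigma>(1)], of i j] injD[OF permutes_inj[OF \<tau>(1)], of "i - n" "j - n"]
      by (auto simp: \<pi>_def split: if_splits)
  qed
  moreover have "\<pi> ` {1..n + m} \<subseteq> {1..n + m}"
  proof
    fix j assume "j \<in> \<pi> ` {1..n + m}"
    then obtain k where k: "1 \<le> k" "k \<le> n + m" "j = \<pi> k" by auto
    then show "j \<in> {1..n + m}"
      using \<sigma>_le[of k] \<sigma>_ge[of k] \<tau>_in[of k] by (cases "k \<le> n") (auto simp: \<pi>_def)
  qed
  ultimately have "bij_betw \<pi> {1..n + m} {1..n + m}"
    by (simp add: bij_betw_def endo_inj_surj)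
  moreover have "\<pi> k = k" if "k \<notin> {1..n + m}" for k
  proof (cases "k \<le> n")
    case True
    then show ?thesis
      using that permutes_not_in[OF \<sigma>(1), of k] by (auto simp: \<pi>_def)
  next
    case False
    then have "k - n \<notin> {1..m}" using that by auto
    then show ?thesis
      using False permutes_not_in[OF \<tau>(1), of "k - n"] by (simp add: \<pi>_def)
  qed
  ultimately have "\<pi> permutes {1..n + m}"
    by (rule bij_imp_permutes)
  then have "matching_cost T (n + m) x y
      \<le> (\<Sum>k=1..n + m. dist ((T ^^ k) x) ((T ^^ \<pi> k) y))"
    by (rule matching_cost_le)
  also have "{1..n + m} = {1..n} \<union> {n + 1..n + m}" by auto
  also have "(\<Sum>k\<in>{1..n} \<union> {n + 1..n + m}. dist ((T ^^ k) x) ((T ^^ \<pi> k) y))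
      = (\<Sum>k=1..n. dist ((T ^^ k) x) ((T ^^ \<pi> k) y))
        + (\<Sum>k=n + 1..n + m. dist ((T ^^ k) x) ((T ^^ \<pi> k) y))"
    by (rule sum.union_disjoint) auto
  also have "(\<Sum>k=1..n. dist ((T ^^ k) x) ((T ^^ \<pi> k) y)) = matching_cost T n x y"
    by (auto simp: \<sigma>(2) \<pi>_def intro!: sum.cong)
  also have "(\<Sum>k=n + 1..n + m. dist ((T ^^ k) x) ((T ^^ \<pi> k) y))
      = matching_cost T m ((T ^^ n) x) ((T ^^ n) y)"
    unfolding \<tau>(2)
  proof (rule sum.reindex_bij_witness[of _ "\<lambda>k. k + n" "\<lambda>k. k - n"], goal_cases)
    \<comment> \<open>This goal is the equality of corresponding summands; the others concern the
      translation of indices by \<open>n\<close>.\<close>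
    case (5 k)
    then have "(T ^^ (k - n)) ((T ^^ n) x) = (T ^^ k) x"
      by (subst funpow_add[THEN fun_cong, unfolded o_apply, symmetric]) simp
    moreover have "(T ^^ \<tau> (k - n)) ((T ^^ n) y) = (T ^^ \<pi> k) y"
      using 5 by (subst funpow_add[THEN fun_cong, unfolded o_apply, symmetric])
        (simp add: \<pi>_def add.commute)
    ultimately show ?case by simp
  qed auto
  finally show ?thesis .
qed

section \<open>Orbits in the invariant set: shift and continuity estimates\<close>

lemma funpow_in_invariant: "T \<in> X \<rightarrow> X \<Longrightarrow> x \<in> X \<Longrightarrow> (T ^^ k) x \<in> X"
  by (induction k) auto

lemma continuous_on_funpow_invariant:
  assumes "continuous_on X T" "T \<in> X \<rightarrow> X"
  shows "continuous_on X (T ^^ k)"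
proof (induction k)
  case (Suc k)
  have "continuous_on X (T \<circ> (T ^^ k))"
    using Suc assms
    by (intro continuous_on_compose)
      (auto intro: continuous_on_subset funpow_in_invariant)
  then show ?case by simp
qed (simp add: id_def)

lemma matching_cost_le_diameter:
  assumes "\<And>u v. u \<in> X \<Longrightarrow> v \<in> X \<Longrightarrow> dist u v \<le> D" "T \<in> X \<rightarrow> X" "x \<in> X" "y \<in> X"
  shows "matching_cost T n x y \<le> real n * D"
proof -
  have "(\<Sum>k=1..n. dist ((T ^^ k) x) ((T ^^ k) y)) \<le> real (card {1..n}) * D"
    by (rule sum_bounded_above) (use assms in \<open>auto intro: funpow_in_invariant\<close>)
  then show ?thesis
    using matching_cost_le_diagonal[of T n x y] by simp
qed

text \<open>The orbit segments of \<open>x\<close> and \<open>T x\<close> share all but one point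
  each, so a cyclic shift pays a single distance. The bound is uniform in \<open>n\<close>.\<close>

lemma matching_cost_step:
  assumes "\<And>u v. u \<in> X \<Longrightarrow> v \<in> X \<Longrightarrow> dist u v \<le> D" "T \<in> X \<rightarrow> X" "x \<in> X"
  shows "matching_cost T n x (T x) \<le> D"
proof (cases "n = 0")
  case True
  then show ?thesis using assms(1)[OF assms(3) assms(3)] by (simp add: matching_cost_def)
next
  case False
  \<comment> \<open>Index \<open>k \<ge> 2\<close> goes to \<open>k - 1\<close>, pairing
    \<open>(T ^^ k) x\<close> with itself; the unmatched first point goes to the last one.\<close>
  define \<sigma> where "\<sigma> k = (if k = 1 then n else if 2 \<le> k \<and> k \<le> n then k - 1 else k)" for k
  have "inj_on \<sigma> {1..n}" "\<sigma> ` {1..n} \<subseteq> {1..n}"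
    by (auto simp: inj_on_def \<sigma>_def)
  then have "bij_betw \<sigma> {1..n} {1..n}"
    by (simp add: bij_betw_def endo_inj_surj)
  then have "\<sigma> permutes {1..n}"
    by (rule bij_imp_permutes) (use False in \<open>auto simp: \<sigma>_def\<close>)
  then have "matching_cost T n x (T x) \<le> (\<Sum>k=1..n. dist ((T ^^ k) x) ((T ^^ \<sigma> k) (T x)))"
    by (rule matching_cost_le)
  also have "\<dots> = (\<Sum>k=1..n. if k = 1 then dist (T x) ((T ^^ n) (T x)) else 0)"
  proof (intro sum.cong refl)
    fix k assume k: "k \<in> {1..n}"
    have "(T ^^ (k - 1)) (T x) = (T ^^ k) x"
      using k funpow_add[of "k - 1" 1 T] by (simp add: fun_eq_iff)
    then show "dist ((T ^^ k) x) ((T ^^ \<sigma> k) (T x))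
        = (if k = 1 then dist (T x) ((T ^^ n) (T x)) else 0)"
      using k by (auto simp: \<sigma>_def)
  qed
  also have "\<dots> = dist (T x) ((T ^^ n) (T x))"
    using False by simp
  also have "\<dots> \<le> D"
    using assms by (intro assms(1) funpow_in_invariant) auto
  finally show ?thesis .
qed

text \<open>Chains \<open>k\<close> single steps. For fixed \<open>k\<close> the cost stays bounded
  in \<open>n\<close>, hence is negligible after division by \<open>n\<close>.\<close>

lemma matching_cost_funpow:
  assumes "\<And>u v. u \<in> X \<Longrightarrow> v \<in> X \<Longrightarrow> dist u v \<le> D" "T \<in> X \<rightarrow> X" "x \<in> X"
  shows "matching_cost T n x ((T ^^ k) x) \<le> real k * D"
proof (induction k)
  case 0
  show ?case using matching_cost_le_diagonal[of T n x x] by simp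
next
  case (Suc k)
  have "matching_cost T n ((T ^^ k) x) (T ((T ^^ k) x)) \<le> D"
    using assms by (intro matching_cost_step[where X = X] funpow_in_invariant) auto
  then show ?case
    using Suc matching_cost_triangle[of T n x "(T ^^ Suc k) x" "(T ^^ k) x"]
    by (simp add: algebra_simps)
qed

text \<open>For fixed \<open>n\<close> only finitely many iterates occur, each continuous on
  \<open>X\<close>, and the diagonal matching suffices.\<close>

lemma matching_cost_tendsto_0:
  assumes "continuous_on X T" "T \<in> X \<rightarrow> X" "\<And>j. u j \<in> X" "a \<in> X" "u \<longlonglongrightarrow> a" "\<epsilon> > 0"
  shows "eventually (\<lambda>j. matching_cost T n (u j) a < \<epsilon>) sequentially"
proof -
  have "(\<lambda>j. (T ^^ k) (u j)) \<longlonglongrightarrow> (T ^^ k) a" for k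
    using continuous_on_tendsto_compose[OF continuous_on_funpow_invariant[OF assms(1,2)] assms(5,4)]
      assms(3) by simp
  then have "(\<lambda>j. \<Sum>k=1..n. dist ((T ^^ k) (u j)) ((T ^^ k) a)) \<longlonglongrightarrow> (\<Sum>k=1..n. 0)"
    by (intro tendsto_sum) (simp add: tendsto_dist_iff[symmetric])
  then have "eventually (\<lambda>j. (\<Sum>k=1..n. dist ((T ^^ k) (u j)) ((T ^^ k) a)) < \<epsilon>) sequentially"
    using assms(6) by (intro order_tendstoD(2)) auto
  then show ?thesis
    by eventually_elim (rule le_less_trans[OF matching_cost_le_diagonal])
qed

section \<open>Chopping long segments, and reading off the upper and lower limits\<close>

text \<open>Think of \<open>a n k\<close> as the cost of the segment of length \<open>n\<close>
  starting at time \<open>k\<close>. Good pieces are cut off greedily; the last incomplete piece is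
  shorter than \<open>N\<close> and costs at most \<open>real N * D\<close>.\<close>

lemma subadditive_cocycle_chop:
  fixes a :: "nat \<Rightarrow> nat \<Rightarrow> real"
  assumes add: "\<And>n m k. a (n + m) k \<le> a n k + a m (k + n)"
    and bound: "\<And>n k. a n k \<le> real n * D"
    and good: "\<And>k. \<exists>n. 1 \<le> n \<and> n \<le> N \<and> a n k \<le> real n * M"
    and "0 \<le> M" "0 \<le> D"
  shows "a n k \<le> real n * M + real N * D"
proof (induction n arbitrary: k rule: less_induct)
  case (less n)
  obtain m where m: "1 \<le> m" "m \<le> N" "a m k \<le> real m * M" using good by blast
  show ?case
  proof (cases "m \<le> n")
    case True
    have "a n k \<le> a m k + a (n - m) (k + m)"
      using add[of m "n - m" k] True by simp
    moreover have "a (n - m) (k + m) \<le> real (n - m) * M + real N * D"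
      using m True by (intro less) auto
    ultimately show ?thesis
      using m(3) True by (simp add: of_nat_diff algebra_simps)
  next
    \<comment> \<open>The next good piece would overshoot, so \<open>n < m \<le> N\<close> and the
      crude bound is enough.\<close>
    case False
    then have "real n * D \<le> real N * D"
      using m \<open>0 \<le> D\<close> by (intro mult_right_mono) auto
    then show ?thesis
      using bound[of n k] mult_nonneg_nonneg[of "real n" M] \<open>0 \<le> M\<close> by linarith
  qed
qed

lemma F_upper_lessD:
  assumes "F_upper T x y < ereal \<epsilon>"
  shows "eventually (\<lambda>n. matching_cost T n x y \<le> real n * \<epsilon>) sequentially"
proof -
  have "eventually (\<lambda>n. ereal (F_mean T x y n) < ereal \<epsilon>) sequentially"
    using assms unfolding F_upper_def by (rule Limsup_lessD)
  then show ?thesis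
    by eventually_elim (simp add: matching_cost_def mult_left_mono)
qed

lemma F_lower_lessD:
  assumes "F_lower T x y < ereal M"
  shows "frequently (\<lambda>n. matching_cost T n x y \<le> real n * M) sequentially"
proof (rule ccontr)
  assume "\<not> ?thesis"
  then have "eventually (\<lambda>n. real n * M < matching_cost T n x y) sequentially"
    by (simp add: not_frequently not_le)
  then have "eventually (\<lambda>n. ereal M \<le> ereal (F_mean T x y n)) sequentially"
    by eventually_elim (auto simp: matching_cost_def mult_less_cancel_left)
  then have "ereal M \<le> F_lower T x y"
    unfolding F_lower_def by (rule Liminf_bounded)
  with assms show False by simp
qed

text \<open>Provides the sign condition on the mean cost required by
  \<open>subadditive_cocycle_chop\<close>.\<close>

lemma F_lower_nonneg: "0 \<le> F_lower T x y"
  unfolding F_lower_def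
proof (intro Liminf_bounded always_eventually allI)
  fix n
  obtain \<sigma> where "matching_cost T n x y = (\<Sum>k=1..n. dist ((T ^^ k) x) ((T ^^ \<sigma> k) y))"
    by (rule matching_cost_attained)
  then have "0 \<le> matching_cost T n x y" by (simp add: sum_nonneg)
  then show "0 \<le> ereal (F_mean T x y n)"
    by (cases "n = 0") (simp add: F_mean_def, simp add: F_mean_eq_matching_cost)
qed

section \<open>Compactness: a uniform length for cheap segments\<close>

text \<open>Starting times without short cheap segments would accumulate at a pair
  \<open>(a, b)\<close>. Some length \<open>n\<close> is cheap for \<open>(a, b)\<close>, and by
  continuity the same \<open>n\<close> is cheap for nearby pairs, a contradiction.\<close>

lemma short_cheap_segment:
  assumes tds: "topological_dynamical_system X T" and cont: "F_upper_continuous X T"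
    and D: "\<And>u v. u \<in> X \<Longrightarrow> v \<in> X \<Longrightarrow> dist u v \<le> D"
    and xy: "x \<in> X" "y \<in> X" and lower: "F_lower T x y < ereal M" and "M < M'"
  shows "\<exists>N. \<forall>k. \<exists>n. 1 \<le> n \<and> n \<le> N \<and>
    matching_cost T n ((T ^^ k) x) ((T ^^ k) y) \<le> real n * M'"
proof (rule ccontr)
  assume "\<not> ?thesis"
  then have "\<forall>N. \<exists>k. \<forall>n. 1 \<le> n \<longrightarrow> n \<le> N \<longrightarrow>
      real n * M' < matching_cost T n ((T ^^ k) x) ((T ^^ k) y)"
    by (meson not_le)
  \<comment> \<open>\<open>\<kappa> N\<close> is a starting time from which every segment of length
    1 to \<open>N\<close> is expensive.\<close>
  then obtain \<kappa> where \<kappa>: "\<And>N n. 1 \<le> n \<Longrightarrow> n \<le> N \<Longrightarrow>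
      real n * M' < matching_cost T n ((T ^^ \<kappa> N) x) ((T ^^ \<kappa> N) y)"
    by metis
  have T: "compact X" "T \<in> X \<rightarrow> X" "continuous_on X T"
    using tds by (auto simp: topological_dynamical_system_def)
  have "seq_compact (X \<times> X)"
    using T(1) by (simp add: compact_Times compact_imp_seq_compact)
  moreover have "\<forall>N. ((T ^^ \<kappa> N) x, (T ^^ \<kappa> N) y) \<in> X \<times> X"
    using xy T(2) by (auto intro: funpow_in_invariant)
  ultimately obtain p r where p: "p \<in> X \<times> X" and r: "strict_mono r"
    and lim: "((\<lambda>N. ((T ^^ \<kappa> N) x, (T ^^ \<kappa> N) y)) \<circ> r) \<longlonglongrightarrow> p"
    by (rule seq_compactE)
  obtain a b where ab: "p = (a, b)" "a \<in> X" "b \<in> X" using p by auto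
  define u v where "u j = (T ^^ \<kappa> (r j)) x" and "v j = (T ^^ \<kappa> (r j)) y" for j
  have uv: "u j \<in> X" "v j \<in> X" for j
    using xy T(2) by (auto simp: u_def v_def intro: funpow_in_invariant)
  have ulim: "u \<longlonglongrightarrow> a" and vlim: "v \<longlonglongrightarrow> b"
    using tendsto_fst[OF lim] tendsto_snd[OF lim] by (simp_all add: ab u_def[abs_def] v_def[abs_def] o_def)
  \<comment> \<open>Five errors share the gap: two from upper continuity at \<open>a\<close> and
    \<open>b\<close>, one from shifting both orbits by \<open>?k\<close>, two from the final
    approximation of \<open>(a, b)\<close>.\<close>
  define \<eta> where "\<eta> = (M' - M) / 5"
  have "\<eta> > 0" using \<open>M < M'\<close> by (simp add: \<eta>_def)
  obtain \<delta>1 where \<delta>1: "\<delta>1 > 0" "\<And>z. z \<in> X \<Longrightarrow> dist a z < \<delta>1 \<Longrightarrow> F_upper T a z < ereal \<eta>"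
    using cont ab(2) \<open>\<eta> > 0\<close>
    unfolding F_upper_continuous_def F_upper_continuous_at_def by meson
  obtain \<delta>2 where \<delta>2: "\<delta>2 > 0" "\<And>z. z \<in> X \<Longrightarrow> dist b z < \<delta>2 \<Longrightarrow> F_upper T b z < ereal \<eta>"
    using cont ab(3) \<open>\<eta> > 0\<close>
    unfolding F_upper_continuous_def F_upper_continuous_at_def by meson
  have "eventually (\<lambda>j. dist (u j) a < \<delta>1 \<and> dist (v j) b < \<delta>2) sequentially"
    using tendstoD[OF ulim \<delta>1(1)] tendstoD[OF vlim \<delta>2(1)] by eventually_elim simp
  then obtain i where i: "dist (u i) a < \<delta>1" "dist (v i) b < \<delta>2"
    by (auto simp: eventually_sequentially)
  \<comment> \<open>With \<open>i\<close> fixed, the shift from \<open>(x, y)\<close> to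
    \<open>(u i, v i)\<close> has a cost bounded independently of \<open>n\<close>.\<close>
  let ?k = "\<kappa> (r i)"
  have ev_a: "eventually (\<lambda>n. matching_cost T n a (u i) \<le> real n * \<eta>) sequentially"
    using \<delta>1(2)[of "u i"] i uv by (intro F_upper_lessD) (auto simp: dist_commute)
  have ev_b: "eventually (\<lambda>n. matching_cost T n b (v i) \<le> real n * \<eta>) sequentially"
    using \<delta>2(2)[of "v i"] i uv by (intro F_upper_lessD) (auto simp: dist_commute)
  obtain m :: nat where m: "2 * (real ?k * D) / \<eta> \<le> real m"
    using real_arch_simple by blast
  have ev_shift: "eventually (\<lambda>n. 2 * (real ?k * D) \<le> real n * \<eta> \<and> 1 \<le> n) sequentially"
    using eventually_ge_at_top[of 1] eventually_ge_at_top[of m]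
  proof eventually_elim
    case (elim n)
    have "2 * (real ?k * D) \<le> real m * \<eta>"
      using m \<open>\<eta> > 0\<close> by (simp add: pos_divide_le_eq)
    also have "\<dots> \<le> real n * \<eta>"
      using elim \<open>\<eta> > 0\<close> by (intro mult_right_mono) auto
    finally show ?case using elim by simp
  qed
  \<comment> \<open>The lower limit controls only infinitely many \<open>n\<close>; the other
    estimates hold for all large \<open>n\<close>, so a common \<open>n\<close> exists.\<close>
  have "frequently (\<lambda>n. matching_cost T n x y \<le> real n * M \<and> matching_cost T n a (u i) \<le> real n * \<eta>
      \<and> matching_cost T n b (v i) \<le> real n * \<eta> \<and> 2 * (real ?k * D) \<le> real n * \<eta> \<and> 1 \<le> n) sequentially"
    by (rule frequently_eventually_frequently[OF F_lower_lessD[OF lower]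
          eventually_conj[OF ev_a eventually_conj[OF ev_b ev_shift]]])
  then obtain n where n: "matching_cost T n a (u i) \<le> real n * \<eta>"
    "matching_cost T n b (v i) \<le> real n * \<eta>" "2 * (real ?k * D) \<le> real n * \<eta>" "1 \<le> n"
    "matching_cost T n x y \<le> real n * M"
    by (auto dest: frequently_ex)
  \<comment> \<open>Follow the chain \<open>a\<close>, \<open>u i\<close>, \<open>x\<close>,
    \<open>y\<close>, \<open>v i\<close>, \<open>b\<close>.\<close>
  have "matching_cost T n a b \<le> matching_cost T n a (u i) + matching_cost T n (u i) x
      + matching_cost T n x y + matching_cost T n y (v i) + matching_cost T n (v i) b"
    using matching_cost_triangle[of T n a b "u i"] matching_cost_triangle[of T n "u i" b x]
      matching_cost_triangle[of T n x b y] matching_cost_triangle[of T n y b "v i"] by linarith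
  moreover have "matching_cost T n (u i) x \<le> real ?k * D"
    using matching_cost_funpow[OF D T(2) xy(1)]
    by (subst matching_cost_commute) (simp add: u_def)
  moreover have "matching_cost T n y (v i) \<le> real ?k * D"
    using matching_cost_funpow[OF D T(2) xy(2)] by (simp add: v_def)
  ultimately have ab_cost: "matching_cost T n a b \<le> real n * M + 3 * (real n * \<eta>)"
    using n matching_cost_commute[of T n b "v i"] by linarith
  have n\<eta>: "real n * \<eta> > 0" using n(4) \<open>\<eta> > 0\<close> by simp
  \<comment> \<open>Now \<open>n\<close> is fixed and \<open>j\<close> grows. The condition
    \<open>n \<le> j\<close> yields \<open>n \<le> r j\<close>, so length \<open>n\<close> is among
    those excluded at time \<open>\<kappa> (r j)\<close>.\<close>
  have "eventually (\<lambda>j. matching_cost T n (u j) a < real n * \<eta> \<and> matching_cost T n (v j) b < real n * \<eta>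
      \<and> n \<le> j) sequentially"
    using matching_cost_tendsto_0[OF T(3,2) uv(1) ab(2) ulim n\<eta>]
      matching_cost_tendsto_0[OF T(3,2) uv(2) ab(3) vlim n\<eta>] eventually_ge_at_top[of n]
    by eventually_elim simp
  then obtain j where j: "matching_cost T n (u j) a < real n * \<eta>"
    "matching_cost T n (v j) b < real n * \<eta>" "n \<le> j"
    by (auto simp: eventually_sequentially)
  have "n \<le> r j" using j(3) seq_suble[OF r, of j] by linarith
  then have "real n * M' < matching_cost T n (u j) (v j)"
    using \<kappa>[OF n(4)] by (simp add: u_def v_def)
  also have "\<dots> \<le> matching_cost T n (u j) a + matching_cost T n a b + matching_cost T n b (v j)"
    using matching_cost_triangle[of T n "u j" "v j" a] matching_cost_triangle[of T n a "v j" b]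
    by linarith
  also have "\<dots> < real n * M + 5 * (real n * \<eta>)"
    using j ab_cost matching_cost_commute[of T n b "v j"] by linarith
  also have "\<dots> = real n * M'"
    by (simp add: \<eta>_def field_simps)
  finally show False by simp
qed

section \<open>Existence of \<open>F\<close> and the equivalence\<close>

lemma F_upper_continuous_imp_F_exists:
  assumes tds: "topological_dynamical_system X T" and cont: "F_upper_continuous X T"
    and xy: "x \<in> X" "y \<in> X"
  shows "F_exists T x y"
proof (rule ccontr)
  assume "\<not> F_exists T x y"
  moreover have "F_lower T x y \<le> F_upper T x y"
    unfolding F_lower_def F_upper_def by (rule Liminf_le_Limsup) simp
  ultimately have "F_lower T x y < F_upper T x y"
    by (auto simp: F_exists_def)
  then obtain M' where M': "F_lower T x y < ereal M'" "ereal M' < F_upper T x y"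
    using ereal_dense2 by blast
  \<comment> \<open>A second real is inserted because \<open>short_cheap_segment\<close> needs room
    between the lower limit level \<open>M\<close> and the mean cost \<open>M'\<close>.\<close>
  then obtain M where M: "F_lower T x y < ereal M" "M < M'"
    using ereal_dense2[of "F_lower T x y" "ereal M'"] by auto
  have "0 \<le> M"
    using F_lower_nonneg[of T x y] M(1) by (metis ereal_less_eq(5) less_imp_le order_trans)
  have T: "compact X" "T \<in> X \<rightarrow> X"
    using tds by (auto simp: topological_dynamical_system_def)
  obtain D where D: "\<And>u v. u \<in> X \<Longrightarrow> v \<in> X \<Longrightarrow> dist u v \<le> D"
    using compact_imp_bounded[OF T(1)] by (auto simp: bounded_two_points)
  have "0 \<le> D" using D[OF xy(1) xy(1)] by simp
  define a where "a n k = matching_cost T n ((T ^^ k) x) ((T ^^ k) y)" for n k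
  obtain N where N: "\<And>k. \<exists>n. 1 \<le> n \<and> n \<le> N \<and> a n k \<le> real n * M'"
    unfolding a_def using short_cheap_segment[OF tds cont D xy M] by blast
  have bound: "a n 0 \<le> real n * M' + real N * D" for n
  proof (rule subadditive_cocycle_chop[OF _ _ N])
    show "a (n + m) k \<le> a n k + a m (k + n)" for n m k
      using matching_cost_add[of T n m "(T ^^ k) x" "(T ^^ k) y"]
      by (simp add: a_def add.commute[of k] funpow_add)
    show "a n k \<le> real n * D" for n k
      unfolding a_def
      using D T(2) xy by (intro matching_cost_le_diameter[where X = X] funpow_in_invariant) auto
  qed (use \<open>0 \<le> M\<close> \<open>0 \<le> D\<close> M(2) in auto)
  \<comment> \<open>After division by \<open>n\<close> the leftover piece contributes
    \<open>real N * D / real n\<close>, which vanishes in the limit.\<close>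
  have "eventually (\<lambda>n. ereal (F_mean T x y n) \<le> ereal (M' + real N * D / real n)) sequentially"
    using eventually_gt_at_top[of 0]
  proof eventually_elim
    case (elim n)
    then show ?case using bound[of n]
      by (simp add: F_mean_eq_matching_cost a_def field_simps)
  qed
  then have "F_upper T x y \<le> limsup (\<lambda>n. ereal (M' + real N * D / real n))"
    unfolding F_upper_def by (rule Limsup_mono)
  also have "(\<lambda>n. M' + real N * D / real n) \<longlonglongrightarrow> M' + 0"
    by (intro tendsto_intros lim_const_over_n)
  then have "limsup (\<lambda>n. ereal (M' + real N * D / real n)) = ereal M'"
    by (intro lim_imp_Limsup) auto
  finally show False using M'(2) by simp
qed

lemma F_value_eq_F_upper: "F_exists T x y \<Longrightarrow> F_value T x y = F_upper T x y"
  unfolding F_value_def F_exists_def by (rule the_equality) auto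

theorem theorem6p1:
  fixes X :: "'a::metric_space set" and T :: "'a \<Rightarrow> 'a"
  assumes "topological_dynamical_system X T"
  shows "F_upper_continuous X T \<longleftrightarrow> F_continuous X T"
proof
  assume cont: "F_upper_continuous X T"
  \<comment> \<open>Existence holds for every pair in \<open>X\<close>, whatever its distance, so
    the same \<open>\<delta>\<close> serves.\<close>
  then show "F_continuous X T"
    using F_upper_continuous_imp_F_exists[OF assms cont]
    by (simp add: F_continuous_def F_continuous_at_def F_upper_continuous_def
        F_upper_continuous_at_def F_value_eq_F_upper cong: imp_cong)
next
  assume "F_continuous X T"
  then show "F_upper_continuous X T"
    unfolding F_continuous_def F_continuous_at_def F_upper_continuous_def
      F_upper_continuous_at_def
    by (metis F_value_eq_F_upper)
qed

end
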